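(* Let $X$ be a real finite dimensional normed space with $\dim X\ge 2$, let $K\subset X$ be a pointed closed convex cone with nonempty interior, and let $A\subset X$ be a nonempty closed set such that $A=A+K\subset K\setminus\{0\}$. Assume that $A\subset\operatorname{int}K$ and $A+(K\setminus\{0\})\subset\operatorname{int}A$. Then $\sigma_A$ is differentiable on $\operatorname{int}K^{-}$ if and only if $A$ is convex and $$\forall a,a'\in\operatorname{bd}A,\ a\neq a',\ \forall\lambda\in(0,1):\ \lambda a+(1-\lambda)a'\notin\operatorname{bd}A.$$
   Context: $X^*$ is the dual of $X$, $\langle x,x^*\rangle:=x^*(x)$. A closed convex cone $K$ is pointed if $K\cap(-K)=\{0\}$. $K^{-}:=\{x^*\in X^*\mid\langle x,x^*\rangle\le0\ \forall x\in K\}$. $\operatorname{bd}A$ is the topological boundary of $A$ in $X$. The support function is $\sigma_A(x^* ):=\sup\{\langle u,x^*\rangle\mid u\in A\}\in(-\infty,+\infty]$ for $x^*\in X^*$. Differentiability may be understood in the Gâteaux or Fréchet sense (they coincide here). *)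

theory Defs
  imports "HOL-Analysis.Analysis"
begin

text \<open>The dual of a finite dimensional space \<open>'a\<close> is the type \<open>'a \<Rightarrow>\<^sub>L real\<close>, since every
  linear functional is bounded there.\<close>

definition finite_dimensional :: "'a::real_vector itself \<Rightarrow> bool"
  where "finite_dimensional _ \<longleftrightarrow> (\<exists>B :: 'a set. finite B \<and> span B = UNIV)"

definition pointed :: "'a::real_vector set \<Rightarrow> bool"
  where "pointed K \<longleftrightarrow> K \<inter> uminus ` K = {0}"

definition negative_polar :: "'a::real_normed_vector set \<Rightarrow> ('a \<Rightarrow>\<^sub>L real) set"
  where "negative_polar K = {f. \<forall>x\<in>K. blinfun_apply f x \<le> 0}"

definition support_fun :: "'a::real_normed_vector set \<Rightarrow> ('a \<Rightarrow>\<^sub>L real) \<Rightarrow> ereal"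
  where "support_fun A f = (SUP u\<in>A. ereal (blinfun_apply f u))"

text \<open>Frechet differentiability of an extended-real-valued function. The finiteness
  requirement is needed because \<open>real_of_ereal\<close> sends infinite values to \<open>0\<close>.\<close>

definition ereal_differentiable_at :: "('b::real_normed_vector \<Rightarrow> ereal) \<Rightarrow> 'b \<Rightarrow> bool"
  where "ereal_differentiable_at g x \<longleftrightarrow>
    (\<forall>\<^sub>F y in nhds x. \<bar>g y\<bar> \<noteq> \<infinity>) \<and> (\<lambda>y. real_of_ereal (g y)) differentiable (at x)"

end

theory Submission
  imports Defs
begin

text \<open>
  For \<open>f\<close> in the interior of \<open>K\<^sup>-\<close> the superlevel sets of \<open>f\<close> on \<open>A\<close> are compact, so
  \<open>\<sigma>\<^sub>A f\<close> is attained, and \<open>\<sigma>\<^sub>A\<close> is differentiable at \<open>f\<close> exactly when the maximizer of \<open>f\<close> on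
  \<open>A\<close> is unique: the evaluations at maximizers are subgradients, and maximizers depend
  continuously on \<open>f\<close> where they are unique.

  If \<open>A\<close> is convex and its boundary contains no inner point of a segment joining two boundary points,
  then maximizers are unique, since the midpoint of two of them would be a boundary point.

  For the converse, take a point \<open>z\<close> that no linear functional strictly separates from \<open>A\<close>, and an
  \<open>e\<close> in the interior of \<open>K\<close>. Moving from \<open>z\<close> along \<open>-e\<close>, stop at the last point
  \<open>y = z - t e\<close> that is still not separated from \<open>A\<close> by functionals in \<open>K\<^sup>-\<close>; by compactness of a base
  of \<open>K\<^sup>-\<close> some \<open>f \<noteq> 0\<close> in \<open>K\<^sup>-\<close> satisfies \<open>f y = \<sigma>\<^sub>A f\<close> (\<open>first_contact\<close>). This \<open>f\<close> attains its
  supremum on \<open>A\<close>, which is shown by perturbing it into the interior of \<open>K\<^sup>-\<close>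
  (\<open>supporting_functional_attained\<close>), and hence it lies in that interior itself: if \<open>f k = 0\<close> for
  some nonzero \<open>k \<in> K\<close>, then \<open>f\<close> would also be maximal at the interior point \<open>a + k\<close> of \<open>A\<close>. Now
  both \<open>y\<close> and the maximizer are subgradients of \<open>\<sigma>\<^sub>A\<close> at \<open>f\<close>, so differentiability makes them equal
  and \<open>y \<in> A\<close> (\<open>differentiable_contact\<close>).
  Applied to points \<open>z\<close> of segments with endpoints in \<open>A\<close>, this gives
  \<open>z = y + t e \<in> A\<close>, that is, convexity. Applied to a boundary point \<open>z\<close> of \<open>A\<close>, it forces
  \<open>t = 0\<close>, so every boundary point is a unique maximizer of some functional; such a point is
  not an inner point of a segment in \<open>A\<close>.

  The perturbation uses that \<open>K\<^sup>-\<close> has interior points. They come from separating \<open>-k\<close> from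
  \<open>K\<close> for the unit vectors \<open>k \<in> K\<close> (\<open>interior_negative_polar_nonempty\<close>).
\<close>

section \<open>Finite dimensional normed spaces\<close>

lemma compact_PiE_UNIV:
  fixes S :: "'i \<Rightarrow> 'b::topological_space set"
  assumes "\<And>i. compact (S i)"
  shows "compact (PiE UNIV S)"
  using assms compactin_PiE[of "\<lambda>i::'i. euclidean :: 'b topology" UNIV S]
  by (simp add: euclidean_product_topology)

text \<open>
  The norm of a linear combination is continuous in its coefficients for the product topology on
  functions, and by independence it is positive on the compact set of coefficient vectors supported
  in \<open>B\<close> with maximum norm \<open>1\<close>. Its minimum there is the constant.
\<close>

lemma coordinate_bound:
  fixes B :: "'a::real_normed_vector set"
  assumes "finite B" "independent B"
  obtains m where "m > 0" "\<And>u b. b \<in> B \<Longrightarrow> m * \<bar>u b\<bar> \<le> norm (\<Sum>b\<in>B. u b *\<^sub>R b)"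
proof -
  let ?L = "\<lambda>u::'a \<Rightarrow> real. norm (\<Sum>b\<in>B. u b *\<^sub>R b)"
  define S where "S = (PiE UNIV (\<lambda>b. if b \<in> B then {-1..1} else {0::real})) \<inter> (\<Union>b\<in>B. {u. \<bar>u b\<bar> = 1})"
  have "compact (PiE UNIV (\<lambda>b. if b \<in> B then {-1..1} else {0::real}))"
    by (intro compact_PiE_UNIV) auto
  moreover have "closed (\<Union>b\<in>B. {u::'a \<Rightarrow> real. \<bar>u b\<bar> = 1})"
    using assms(1) by (intro closed_UN ballI closed_Collect_eq continuous_intros) auto
  ultimately have S: "compact S"
    unfolding S_def by (rule compact_Int_closed)
  have cont: "continuous_on S ?L"
    by (intro continuous_intros continuous_on_subset[OF continuous_on_product_coordinates]) auto
  have pos: "?L u > 0" if uS: "u \<in> S" for u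
  proof -
    obtain b where "b \<in> B" "\<bar>u b\<bar> = 1" using uS unfolding S_def by blast
    then have "b \<in> B" "u b \<noteq> 0" by auto
    then have "(\<Sum>b\<in>B. u b *\<^sub>R b) \<noteq> 0"
      using assms by (auto simp: dependent_finite)
    then show ?thesis by simp
  qed
  obtain m where m: "m > 0" "\<And>u. u \<in> S \<Longrightarrow> m \<le> ?L u"
  proof (cases "S = {}")
    case True
    then show ?thesis using that[of 1] by auto
  next
    case False
    then obtain v where "v \<in> S" "\<forall>u\<in>S. ?L v \<le> ?L u"
      using continuous_attains_inf[OF S _ cont] by blast
    then show ?thesis using that[of "?L v"] pos by blast
  qed
  have "m * \<bar>u b\<bar> \<le> ?L u" if "b \<in> B" for u b
  proof -
    define M where "M = Max ((\<lambda>b. \<bar>u b\<bar>) ` B)"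
    have le: "\<bar>u b\<bar> \<le> M" if "b \<in> B" for b
      unfolding M_def using assms(1) that by auto
    have "M \<in> (\<lambda>b. \<bar>u b\<bar>) ` B"
      unfolding M_def using assms(1) that by (intro Max_in) auto
    then obtain b' where b': "b' \<in> B" "\<bar>u b'\<bar> = M" by auto
    show ?thesis
    proof (cases "M = 0")
      case True
      then show ?thesis using le[OF that] by simp
    next
      case False
      then have M: "M > 0" using b' by auto
      let ?v = "\<lambda>b. if b \<in> B then u b / M else 0"
      have "?v \<in> S"
        using le M b' by (fastforce simp: S_def abs_le_iff divide_simps PiE_iff)
      then have "m \<le> ?L ?v" by (rule m)
      also have "(\<Sum>b\<in>B. ?v b *\<^sub>R b) = (1 / M) *\<^sub>R (\<Sum>b\<in>B. u b *\<^sub>R b)"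
        by (auto simp: scaleR_sum_right intro!: sum.cong)
      also have "norm \<dots> = ?L u / M" using M by simp
      finally have "m * M \<le> ?L u" using M by (simp add: field_simps)
      then show ?thesis using le[OF that] m(1)
        by (meson mult_left_mono less_imp_le order_trans)
    qed
  qed
  then show ?thesis using m(1) that by blast
qed

text \<open>
  Coordinates with respect to a basis are continuous linear functionals. This one fact carries the
  Heine--Borel property, the finite dimension of the dual and the inner product used below.
\<close>

lemma finite_dimensional_coordinates:
  assumes "finite_dimensional TYPE('a::real_normed_vector)"
  obtains B :: "'a::real_normed_vector set" and c :: "'a \<Rightarrow> 'a::real_normed_vector \<Rightarrow>\<^sub>L real"
  where "finite B" "\<And>x. (\<Sum>b\<in>B. c b x *\<^sub>R b) = x"
proof -
  obtain B0 :: "'a set" where B0: "finite B0" "span B0 = UNIV"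
    using assms by (auto simp: finite_dimensional_def)
  obtain B where B: "B \<subseteq> B0" "independent B" "B0 \<subseteq> span B"
    using maximal_independent_subset by blast
  have fin: "finite B" using B B0 finite_subset by blast
  have sp: "span B = UNIV"
    using B B0 by (metis span_mono span_span top.extremum_uniqueI)
  let ?r = "\<lambda>b x. representation B x b"
  have rep: "(\<Sum>b\<in>B. ?r b x *\<^sub>R b) = x" for x
    using sum_representation_eq[of B x B] B fin sp by simp
  obtain m where m: "m > 0" "\<And>u b. b \<in> B \<Longrightarrow> m * \<bar>u b\<bar> \<le> norm (\<Sum>b\<in>B. u b *\<^sub>R b)"
    using coordinate_bound[OF fin B(2)] by blast
  have bl: "bounded_linear (?r b)" if "b \<in> B" for b
  proof (rule bounded_linear_intro)
    show "norm (?r b x) \<le> norm x * (1 / m)" for x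
      using m(2)[OF that, of "representation B x"] rep[of x] m(1) by (simp add: field_simps)
  qed (use B sp in \<open>simp_all add: representation_add representation_scale\<close>)
  show ?thesis
    by (rule that[of B "\<lambda>b. Blinfun (?r b)"])
       (use fin rep bl in \<open>simp_all add: bounded_linear_Blinfun_apply\<close>)
qed

text \<open>
  The coordinates of points of a bounded set stay in a compact box.
\<close>

lemma finite_dimensional_compact:
  fixes S :: "'a::real_normed_vector set"
  assumes "finite_dimensional TYPE('a)" "closed S" "bounded S"
  shows "compact S"
proof -
  obtain B and c :: "'a \<Rightarrow> 'a \<Rightarrow>\<^sub>L real"
    where B: "finite B" "\<And>x. (\<Sum>b\<in>B. c b x *\<^sub>R b) = x"
    using finite_dimensional_coordinates[OF assms(1)] by blast
  obtain R where R: "\<And>x. x \<in> S \<Longrightarrow> norm x \<le> R"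
    using assms(3) by (auto simp: bounded_iff)
  let ?box = "PiE UNIV (\<lambda>b. {- (norm (c b) * R)..norm (c b) * R})"
  let ?F = "\<lambda>u::'a \<Rightarrow> real. \<Sum>b\<in>B. u b *\<^sub>R b"
  have "compact ?box"
    by (intro compact_PiE_UNIV) auto
  moreover have "continuous_on ?box ?F"
    by (intro continuous_intros continuous_on_subset[OF continuous_on_product_coordinates]) auto
  ultimately have "compact (?F ` ?box)" by (rule compact_continuous_image[rotated])
  moreover have "S \<subseteq> ?F ` ?box"
  proof
    fix x assume "x \<in> S"
    then have "\<bar>c b x\<bar> \<le> norm (c b) * R" for b
      using norm_blinfun[of "c b" x] R[of x] by (smt (verit) mult_left_mono norm_ge_zero real_norm_def)
    then have "(\<lambda>b. c b x) \<in> ?box" by (auto simp: abs_le_iff minus_le_iff)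
    moreover have "x = ?F (\<lambda>b. c b x)" using B by simp
    ultimately show "x \<in> ?F ` ?box"
      by (intro image_eqI[where x = "\<lambda>b. c b x"])
  qed
  ultimately show ?thesis
    using assms(2) compact_Int_closed[of "?F ` ?box" S] by (simp add: Int_absorb1)
qed

lemma finite_dimensional_dual:
  assumes "finite_dimensional TYPE('a::real_normed_vector)"
  shows "finite_dimensional TYPE('a::real_normed_vector \<Rightarrow>\<^sub>L real)"
proof -
  obtain B and c :: "'a \<Rightarrow> 'a \<Rightarrow>\<^sub>L real"
    where B: "finite B" "\<And>x. (\<Sum>b\<in>B. c b x *\<^sub>R b) = x"
    using finite_dimensional_coordinates[OF assms(1)] by blast
  have "f \<in> span (c ` B)" for f :: "'a \<Rightarrow>\<^sub>L real"
  proof -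
    have "f x = (\<Sum>b\<in>B. f b *\<^sub>R c b) x" for x
    proof -
      have "f x = f (\<Sum>b\<in>B. c b x *\<^sub>R b)" using B(2) by simp
      also have "\<dots> = (\<Sum>b\<in>B. f b *\<^sub>R c b) x"
        by (simp add: blinfun.sum_right blinfun.sum_left blinfun.scaleR_right blinfun.scaleR_left mult.commute)
      finally show ?thesis .
    qed
    then have "f = (\<Sum>b\<in>B. f b *\<^sub>R c b)" by (intro blinfun_eqI)
    then show ?thesis
      by (metis (no_types, lifting) imageI span_base span_scale span_sum)
  qed
  then show ?thesis
    using B(1) by (auto simp: finite_dimensional_def intro!: exI[of _ "c ` B"])
qed

lemma dual_separates_points:
  fixes x y :: "'a::real_normed_vector"
  assumes "finite_dimensional TYPE('a)" "\<And>h :: 'a \<Rightarrow>\<^sub>L real. h x = h y"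
  shows "x = y"
proof -
  obtain B and c :: "'a \<Rightarrow> 'a \<Rightarrow>\<^sub>L real"
    where B: "\<And>x. (\<Sum>b\<in>B. c b x *\<^sub>R b) = x"
    using finite_dimensional_coordinates[OF assms(1)] by blast
  have "(\<Sum>b\<in>B. c b x *\<^sub>R b) = (\<Sum>b\<in>B. c b y *\<^sub>R b)"
    using assms(2) by simp
  then show ?thesis by (simp only: B)
qed

text \<open>
  Coordinates define an inner product \<open>q\<close>. If \<open>p\<close> is the \<open>q\<close>-nearest point of \<open>K\<close> to \<open>x\<close>, the
  separating functional is \<open>q (x - p)\<close>: moving from \<open>p\<close> in directions \<open>k \<in> K\<close> and \<open>-p\<close> stays in
  the cone and does not decrease the distance.
\<close>

lemma closed_convex_cone_separation:
  fixes K :: "'a::real_normed_vector set"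
  assumes fd: "finite_dimensional TYPE('a)"
    and K: "closed K" "convex K" "cone K" "0 \<in> K" and x: "x \<notin> K"
  obtains f where "f \<in> negative_polar K" "blinfun_apply f x > 0"
proof -
  obtain B and c :: "'a \<Rightarrow> 'a \<Rightarrow>\<^sub>L real"
    where B: "finite B" "\<And>x. (\<Sum>b\<in>B. c b x *\<^sub>R b) = x"
    using finite_dimensional_coordinates[OF fd] by blast
  define q where "q v w = (\<Sum>b\<in>B. c b v * c b w)" for v w
  have q_lin: "q v (w - w') = q v w - q v w'" "q v (s *\<^sub>R w) = s * q v w" for v w w' s
    by (simp_all add: q_def blinfun.diff_right blinfun.scaleR_right
        algebra_simps sum_subtractf sum_distrib_left)
  have q_expand: "q (v - s *\<^sub>R w) (v - s *\<^sub>R w) = q v v + s * (s * q w w - 2 * q v w)" for v w s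
    by (simp add: q_def blinfun.diff_right blinfun.scaleR_right algebra_simps
        sum.distrib sum_subtractf sum_distrib_left)
  have q_pos: "q v v \<ge> 0" for v by (simp add: q_def sum_nonneg)
  have q_zero: "v = 0" if "q v v = 0" for v
  proof -
    have "\<forall>b\<in>B. c b v * c b v = 0"
      using that B(1) unfolding q_def by (subst (asm) sum_nonneg_eq_0_iff) auto
    then show ?thesis using B(2)[of v] by simp
  qed
  define P where "P = K \<inter> {p. q (x - p) (x - p) \<le> q x x}"
  have cont: "continuous_on S (\<lambda>p. q (x - p) (x - p))" for S
    unfolding q_def by (intro continuous_intros)
  have "closed P"
    unfolding P_def using K(1) cont by (intro closed_Int closed_Collect_le) auto
  moreover have "bounded P"
  proof -
    have "norm p \<le> norm x + (\<Sum>b\<in>B. sqrt (q x x) * norm b)" if "p \<in> P" for p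
    proof -
      have "\<bar>c b (x - p)\<bar> \<le> sqrt (q x x)" if "b \<in> B" for b
      proof -
        have "(c b (x - p))\<^sup>2 \<le> q (x - p) (x - p)"
          unfolding q_def power2_eq_square
          using B(1) that by (intro member_le_sum[where f = "\<lambda>b. c b (x - p) * c b (x - p)"]) auto
        also have "\<dots> \<le> q x x" using \<open>p \<in> P\<close> by (simp add: P_def)
        finally show ?thesis by (metis real_sqrt_abs real_sqrt_le_iff)
      qed
      then have "norm (\<Sum>b\<in>B. c b (x - p) *\<^sub>R b) \<le> (\<Sum>b\<in>B. sqrt (q x x) * norm b)"
        by (intro sum_norm_le) (auto intro: mult_right_mono)
      then have "norm (x - p) \<le> (\<Sum>b\<in>B. sqrt (q x x) * norm b)" using B(2) by simp
      then show ?thesis using norm_triangle_sub[of p x] by (simp add: norm_minus_commute)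
    qed
    then show ?thesis by (auto simp: bounded_iff)
  qed
  ultimately have "compact P" by (rule finite_dimensional_compact[OF fd])
  moreover have "0 \<in> P" using K(4) by (simp add: P_def)
  ultimately obtain p where p: "p \<in> P" "\<And>r. r \<in> P \<Longrightarrow> q (x - p) (x - p) \<le> q (x - r) (x - r)"
    using continuous_attains_inf[of P, OF _ _ cont] by blast
  have pK: "p \<in> K" using p(1) by (simp add: P_def)
  have min: "q (x - p) (x - p) \<le> q (x - r) (x - r)" if "r \<in> K" for r
    using p that by (cases "r \<in> P") (auto simp: P_def)
  \<comment> \<open>First-order condition at the minimizer, with its quadratic remainder.\<close>
  have var: "2 * q (x - p) w \<le> s * q w w" if "s > 0" "p + s *\<^sub>R w \<in> K" for s w
  proof -
    have "q (x - p) (x - p) \<le> q ((x - p) - s *\<^sub>R w) ((x - p) - s *\<^sub>R w)"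
      using min[OF that(2)] by (simp add: diff_diff_eq)
    also have "\<dots> = q (x - p) (x - p) + s * (s * q w w - 2 * q (x - p) w)"
      by (rule q_expand)
    finally have "0 \<le> s * (s * q w w - 2 * q (x - p) w)" by simp
    then show ?thesis using that(1) by (simp add: zero_le_mult_iff)
  qed
  have var0: "q (x - p) w \<le> 0" if "\<And>s. 0 < s \<Longrightarrow> s \<le> 1 \<Longrightarrow> p + s *\<^sub>R w \<in> K" for w
  proof (rule ccontr)
    assume "\<not> ?thesis"
    then have pos: "q (x - p) w > 0" by simp
    \<comment> \<open>A step so short that the quadratic remainder cannot compensate the linear gain.\<close>
    define s where "s = min 1 (q (x - p) w / (q w w + 1))"
    have s: "0 < s" "s \<le> 1" using pos q_pos[of w] by (auto simp: s_def)
    have "s * q w w \<le> q (x - p) w / (q w w + 1) * q w w"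
      using q_pos[of w] by (intro mult_right_mono) (auto simp: s_def)
    also have "\<dots> \<le> q (x - p) w"
      using pos q_pos[of w] by (simp add: divide_simps mult_left_mono algebra_simps)
    finally show False using var[OF s(1) that[OF s]] pos by simp
  qed
  have add: "u + v \<in> K" if "u \<in> K" "v \<in> K" for u v
    using K(2,3) that convex_cone by blast
  have sc: "s *\<^sub>R u \<in> K" if "u \<in> K" "s \<ge> 0" for u s
    using K(3) that by (simp add: cone_def)
  have polar: "q (x - p) k \<le> 0" if "k \<in> K" for k
    using that pK by (intro var0 add sc) auto
  have "q (x - p) (- p) \<le> 0"
  proof (rule var0)
    fix s :: real assume "0 < s" "s \<le> 1"
    then have "(1 - s) *\<^sub>R p \<in> K" using sc[OF pK] by simp
    then show "p + s *\<^sub>R (- p) \<in> K" by (simp add: algebra_simps)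
  qed
  then have "q (x - p) (x - p) \<le> q (x - p) x"
    using q_lin(2)[of "x - p" "-1" p] by (simp add: q_lin(1))
  moreover have "q (x - p) (x - p) > 0"
    using q_pos[of "x - p"] q_zero[of "x - p"] x pK by force
  ultimately have xpos: "q (x - p) x > 0" by linarith
  have app: "(\<Sum>b\<in>B. c b (x - p) *\<^sub>R c b) v = q (x - p) v" for v
    by (simp add: q_def blinfun.sum_left blinfun.scaleR_left)
  show ?thesis
    by (rule that[of "\<Sum>b\<in>B. c b (x - p) *\<^sub>R c b"])
       (simp_all only: negative_polar_def mem_Collect_eq app polar xpos, simp add: polar)
qed

section \<open>Support functions and their subgradients\<close>

lemma functional_maximal_in_interior_zero:
  fixes f :: "'a::real_normed_vector \<Rightarrow>\<^sub>L real"
  assumes "x \<in> interior A" "\<And>y. y \<in> A \<Longrightarrow> f y \<le> f x"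
  shows "f = 0"
proof -
  obtain r where r: "r > 0" "ball x r \<subseteq> A"
    using assms(1) by (meson mem_interior)
  have le: "f v \<le> 0" for v
  proof (cases "v = 0")
    case False
    define s where "s = r / (2 * norm v)"
    have s: "s > 0" using r False by (simp add: s_def)
    have "x + s *\<^sub>R v \<in> ball x r"
      using r False by (simp add: s_def dist_norm)
    then have "f (x + s *\<^sub>R v) \<le> f x" using r assms(2) by blast
    then show ?thesis using s by (simp add: blinfun.add_right blinfun.scaleR_right mult_le_0_iff)
  qed simp
  have "f v = 0" for v
    using le[of v] le[of "- v"] by (simp add: blinfun.minus_right)
  then show ?thesis by (intro blinfun_eqI) simp
qed

lemma support_fun_eq_maximum:
  assumes "a \<in> A" "\<And>x. x \<in> A \<Longrightarrow> blinfun_apply f x \<le> f a"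
  shows "support_fun A f = ereal (f a)"
  unfolding support_fun_def using assms by (intro antisym SUP_least SUP_upper2[of a]) auto

lemma support_fun_upper: "a \<in> A \<Longrightarrow> ereal (blinfun_apply f a) \<le> support_fun A f"
  unfolding support_fun_def by (rule SUP_upper)

text \<open>
  A point \<open>w\<close> with \<open>g w \<le> \<sigma>\<^sub>A g\<close> near \<open>f\<close> and equality at \<open>f\<close> makes \<open>\<sigma>\<^sub>A g - g w\<close> locally minimal
  at \<open>f\<close>, so the derivative of \<open>\<sigma>\<^sub>A\<close> at \<open>f\<close> is evaluation at \<open>w\<close>, which determines \<open>w\<close>. Applied to
  a contact point and a maximizer, this shows that the contact point lies in \<open>A\<close>.
\<close>

lemma differentiable_support_fun_unique_contact:
  fixes A :: "'a::real_normed_vector set"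
  assumes fd: "finite_dimensional TYPE('a)"
    and diff: "ereal_differentiable_at (support_fun A) f"
    and y: "\<forall>\<^sub>F g in nhds f. ereal (blinfun_apply g y) \<le> support_fun A g" "support_fun A f = ereal (f y)"
    and z: "\<forall>\<^sub>F g in nhds f. ereal (blinfun_apply g z) \<le> support_fun A g" "support_fun A f = ereal (f z)"
  shows "y = z"
proof -
  let ?s = "\<lambda>g. real_of_ereal (support_fun A g)"
  have fin: "\<forall>\<^sub>F g in nhds f. \<bar>support_fun A g\<bar> \<noteq> \<infinity>"
    using diff by (simp add: ereal_differentiable_at_def)
  obtain D where D: "(?s has_derivative D) (at f)"
    using diff by (auto simp: ereal_differentiable_at_def differentiable_def)
  have eval: "D h = h w"
    if w: "\<forall>\<^sub>F g in nhds f. ereal (blinfun_apply g w) \<le> support_fun A g" "support_fun A f = ereal (f w)"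
    for w h
  proof -
    have "((\<lambda>g. ?s g - blinfun_apply g w) has_derivative (\<lambda>h. D h - blinfun_apply h w)) (at f)"
      by (intro has_derivative_diff D bounded_linear.has_derivative[OF _ has_derivative_ident]
          bounded_linear_intros)
    moreover have "\<forall>\<^sub>F g in at f. ?s f - blinfun_apply f w \<le> ?s g - blinfun_apply g w"
    proof -
      have "\<forall>\<^sub>F g in nhds f. ?s f - blinfun_apply f w \<le> ?s g - blinfun_apply g w"
        using fin w(1) by eventually_elim (use w(2) in \<open>auto simp: ereal_le_real_iff\<close>)
      then show ?thesis by (simp add: eventually_at_filter eventually_mono)
    qed
    ultimately have "(\<lambda>h. D h - blinfun_apply h w) = (\<lambda>h. 0)"
      by (rule has_derivative_local_min)
    then show ?thesis by (metis eq_iff_diff_eq_0)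
  qed
  show ?thesis
    using eval[OF y] eval[OF z] by (intro dual_separates_points[OF fd]) metis
qed

section \<open>Pointed cones and the interior of the polar\<close>

locale pointed_closed_cone =
  fixes K :: "'a::real_normed_vector set"
  assumes fd: "finite_dimensional TYPE('a)"
    and closed_K: "closed K" and convex_K: "convex K" and cone_K: "cone K" and pointed_K: "pointed K"
begin

lemma zero_in_K: "0 \<in> K"
  using pointed_K by (auto simp: pointed_def)

lemma scale_in_K: "k \<in> K \<Longrightarrow> 0 \<le> s \<Longrightarrow> s *\<^sub>R k \<in> K"
  using cone_K by (simp add: cone_def)

lemma compact_unit_section: "compact (K \<inter> sphere 0 1)"
proof (intro finite_dimensional_compact[OF fd] closed_Int closed_K)
  show "closed (sphere (0::'a) 1)"
    unfolding sphere_def by (intro closed_Collect_eq continuous_intros)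
  show "bounded (K \<inter> sphere 0 1)"
    by (rule bounded_subset[OF bounded_cball[of 0 1]]) auto
qed

text \<open>
  Compactness of the unit section turns strict negativity into a linear bound.
\<close>

lemma uniformly_negative:
  fixes f :: "'a \<Rightarrow>\<^sub>L real"
  assumes "\<And>x. x \<in> K \<Longrightarrow> x \<noteq> 0 \<Longrightarrow> blinfun_apply f x < 0"
  obtains c where "c > 0" "\<And>x. x \<in> K \<Longrightarrow> blinfun_apply f x \<le> - c * norm x"
proof -
  obtain c where c: "c > 0" "\<And>x. x \<in> K \<inter> sphere 0 1 \<Longrightarrow> f x \<le> - c"
  proof (cases "K \<inter> sphere 0 1 = {}")
    case True
    show ?thesis by (rule that[of 1]) (use True in simp_all)
  next
    case False
    moreover have "continuous_on (K \<inter> sphere 0 1) (blinfun_apply f)" by (intro continuous_intros)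
    ultimately obtain v where v: "v \<in> K \<inter> sphere 0 1" "\<forall>x\<in>K \<inter> sphere 0 1. f x \<le> f v"
      using continuous_attains_sup[OF compact_unit_section] by blast
    have "f v < 0" by (rule assms) (use v(1) in auto)
    then show ?thesis by (intro that[of "- f v"]) (use v(2) in simp_all)
  qed
  have "f x \<le> - c * norm x" if "x \<in> K" for x
  proof (cases "x = 0")
    case False
    then have "(1 / norm x) *\<^sub>R x \<in> K \<inter> sphere 0 1"
      using that scale_in_K by auto
    then have "f ((1 / norm x) *\<^sub>R x) \<le> - c" by (rule c)
    then show ?thesis using False by (simp add: blinfun.scaleR_right field_simps)
  qed simp
  then show ?thesis using c that by blast
qed

text \<open>
  If \<open>f x = 0\<close> for some nonzero \<open>x \<in> K\<close>, adding a small multiple of a functional positive at \<open>x\<close>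
  leaves the polar; conversely the bound \<open>- c * norm x\<close> leaves room for perturbations of norm \<open>c\<close>.
\<close>

lemma interior_negative_polar:
  "interior (negative_polar K) = {f :: 'a \<Rightarrow>\<^sub>L real. \<forall>x\<in>K. x \<noteq> 0 \<longrightarrow> blinfun_apply f x < 0}"
proof (intro set_eqI iffI)
  fix f assume "f \<in> interior (negative_polar K)"
  then obtain r where r: "r > 0" "ball f r \<subseteq> negative_polar K"
    by (meson mem_interior)
  have "f x < 0" if x: "x \<in> K" "x \<noteq> 0" for x
  proof -
    obtain h :: "'a \<Rightarrow>\<^sub>L real" where "h x \<noteq> h 0"
      using dual_separates_points[OF fd] x(2) by blast
    then obtain h :: "'a \<Rightarrow>\<^sub>L real" where h: "h x > 0"
      by (metis blinfun.zero_right blinfun.minus_left linorder_cases neg_0_less_iff_less)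
    then have hn: "norm h > 0" by auto
    have "f + (r / (2 * norm h)) *\<^sub>R h \<in> ball f r"
      using r(1) hn by (simp add: dist_norm)
    then have "f x + r / (2 * norm h) * h x \<le> 0"
      using r(2) x(1) by (auto simp: negative_polar_def blinfun.add_left blinfun.scaleR_left)
    moreover have "r / (2 * norm h) * h x > 0"
      using r(1) hn h by simp
    ultimately show ?thesis by linarith
  qed
  then show "f \<in> {f. \<forall>x\<in>K. x \<noteq> 0 \<longrightarrow> blinfun_apply f x < 0}" by blast
next
  fix f :: "'a \<Rightarrow>\<^sub>L real" assume "f \<in> {f. \<forall>x\<in>K. x \<noteq> 0 \<longrightarrow> blinfun_apply f x < 0}"
  then obtain c where c: "c > 0" "\<And>x. x \<in> K \<Longrightarrow> f x \<le> - c * norm x"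
    using uniformly_negative[of f] by blast
  have "ball f c \<subseteq> negative_polar K"
  proof
    fix g assume "g \<in> ball f c"
    then have "norm (g - f) \<le> c" by (simp add: dist_norm norm_minus_commute)
    moreover have "(g - f) x \<le> norm (g - f) * norm x" for x
      using norm_blinfun[of "g - f" x] by simp
    ultimately have "(g - f) x \<le> c * norm x" for x
      by (meson mult_right_mono norm_ge_zero order_trans)
    then have "g x \<le> 0" if "x \<in> K" for x
      using c(2)[OF that] by (smt (verit) blinfun.diff_left mult_minus_left)
    then show "g \<in> negative_polar K" by (simp add: negative_polar_def)
  qed
  then show "f \<in> interior (negative_polar K)" using c(1) by (meson mem_interior)
qed

lemma scale_interior_polar:
  assumes "g \<in> interior (negative_polar K)" "s > 0"
  shows "s *\<^sub>R g \<in> interior (negative_polar K)"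
  using assms by (simp add: interior_negative_polar blinfun.scaleR_left mult_pos_neg)

text \<open>
  Since \<open>K\<close> is pointed, each unit vector \<open>k \<in> K\<close> has \<open>-k \<notin> K\<close>, so separation gives a polar
  functional negative at \<open>k\<close>, and by continuity near \<open>k\<close>. Finitely many of these neighbourhoods
  cover the unit section of \<open>K\<close>, and the sum of their functionals is negative on all of it.
\<close>

lemma interior_negative_polar_nonempty: "interior (negative_polar K) \<noteq> {}"
proof -
  let ?S = "K \<inter> sphere 0 1"
  have "\<exists>f. f \<in> negative_polar K \<and> blinfun_apply f k < 0" if "k \<in> ?S" for k
  proof -
    have "- k \<notin> K"
      using that pointed_K by (force simp: pointed_def)
    then obtain f where "f \<in> negative_polar K" "blinfun_apply f (- k) > 0"
      using closed_convex_cone_separation[OF fd closed_K convex_K cone_K zero_in_K] by blast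
    then show ?thesis by (auto simp: blinfun.minus_right)
  qed
  then obtain F where F: "\<And>k. k \<in> ?S \<Longrightarrow> F k \<in> negative_polar K \<and> blinfun_apply (F k) k < 0"
    by metis
  have "open {x. blinfun_apply (F k) x < 0}" for k
    by (intro open_Collect_less continuous_intros)
  then obtain C where C: "C \<subseteq> ?S" "finite C" "?S \<subseteq> (\<Union>k\<in>C. {x. blinfun_apply (F k) x < 0})"
    by (rule compactE_image[OF compact_unit_section, of ?S "\<lambda>k. {x. blinfun_apply (F k) x < 0}"])
       (use F in auto)
  have "(\<Sum>k\<in>C. F k) x < 0" if x: "x \<in> K" "x \<noteq> 0" for x
  proof -
    have "(1 / norm x) *\<^sub>R x \<in> ?S" using x scale_in_K by auto
    then obtain k where k: "k \<in> C" "F k ((1 / norm x) *\<^sub>R x) < 0" using C(3) by blast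
    then have "F k x < 0" using x(2) by (simp add: blinfun.scaleR_right divide_less_0_iff)
    moreover have "\<And>k. k \<in> C \<Longrightarrow> F k x \<le> 0"
      using F C(1) x(1) unfolding negative_polar_def by blast
    ultimately have "(\<Sum>k\<in>C. - F k x) > 0"
      using k(1) C(2) by (intro sum_pos2[of _ k]) auto
    then show ?thesis by (simp add: blinfun.sum_left sum_negf)
  qed
  then show ?thesis unfolding interior_negative_polar by blast
qed

lemma compact_superlevel:
  assumes f: "f \<in> interior (negative_polar K)" and A: "closed A" "A \<subseteq> K"
  shows "compact {a \<in> A. r \<le> blinfun_apply f a}"
proof -
  obtain c where c: "c > 0" "\<And>x. x \<in> K \<Longrightarrow> f x \<le> - c * norm x"
    using f uniformly_negative[of f] unfolding interior_negative_polar by blast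
  have "norm a \<le> - r / c" if "a \<in> {a \<in> A. r \<le> f a}" for a
    using c(2)[of a] c(1) A(2) that by (auto simp: field_simps)
  then have "bounded {a \<in> A. r \<le> f a}" by (auto simp only: bounded_iff)
  moreover have "closed (A \<inter> {a. r \<le> f a})"
    using A(1) by (intro closed_Int closed_Collect_le continuous_intros)
  ultimately show ?thesis
    using finite_dimensional_compact[OF fd] by (simp add: Int_def)
qed

lemma maximum_attained:
  assumes f: "f \<in> interior (negative_polar K)" and A: "closed A" "A \<subseteq> K" "A \<noteq> {}"
  obtains a where "a \<in> A" "\<And>x. x \<in> A \<Longrightarrow> blinfun_apply f x \<le> f a"
proof -
  obtain b where b: "b \<in> A" using A(3) by blast
  have "continuous_on {a \<in> A. f b \<le> f a} (blinfun_apply f)" by (intro continuous_intros)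
  then obtain a where "a \<in> A" "f b \<le> f a" "\<forall>x\<in>{a \<in> A. f b \<le> f a}. f x \<le> f a"
    using continuous_attains_sup[OF compact_superlevel[OF f A(1,2), of "f b"]] b by blast
  then show ?thesis using that[of a] by force
qed

text \<open>
  Polar functionals with value \<open>-1\<close> at \<open>e\<close> are bounded: on a ball \<open>cball e r \<subseteq> K\<close> they are
  nonpositive, so on the ball \<open>cball 0 r\<close> they are at most \<open>1\<close>.
\<close>

lemma compact_polar_base:
  assumes "e \<in> interior K"
  shows "compact {f \<in> negative_polar K. blinfun_apply f e = -1}"
proof -
  obtain r where r: "r > 0" "cball e r \<subseteq> K"
    using assms by (meson mem_interior_cball)
  have cont: "continuous_on UNIV (\<lambda>f :: 'a \<Rightarrow>\<^sub>L real. f x)" for x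
    by (intro linear_continuous_on bounded_linear_intros)
  have "closed {f. blinfun_apply f x \<le> (0::real)}" for x :: 'a
    by (rule closed_Collect_le[OF cont continuous_on_const])
  moreover have "closed {f. blinfun_apply f e = (-1::real)}"
    by (rule closed_Collect_eq[OF cont continuous_on_const])
  ultimately have "closed ((\<Inter>x\<in>K. {f. blinfun_apply f x \<le> (0::real)}) \<inter> {f. blinfun_apply f e = -1})"
    by (intro closed_Int closed_INT) auto
  also have "\<dots> = {f \<in> negative_polar K. blinfun_apply f e = -1}"
    by (auto simp: negative_polar_def)
  finally have cl: "closed {f \<in> negative_polar K. blinfun_apply f e = -1}" .
  have "norm f \<le> 1 / r" if f: "f \<in> negative_polar K" "f e = -1" for f
  proof (rule norm_blinfun_bound)
    have le: "f v \<le> 1 / r * norm v" for v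
    proof (cases "v = 0")
      case False
      have "e + (r / norm v) *\<^sub>R v \<in> K"
        using r False by (intro subsetD[OF r(2)]) (simp add: dist_norm)
      then have "f (e + (r / norm v) *\<^sub>R v) \<le> 0" using f(1) by (simp add: negative_polar_def)
      then show ?thesis
        using False r(1) f(2) by (simp add: blinfun.add_right blinfun.scaleR_right field_simps)
    qed simp
    show "norm (f v) \<le> 1 / r * norm v" for v
      using le[of v] le[of "- v"] by (simp add: blinfun.minus_right abs_le_iff)
  qed (use r in simp)
  then have "bounded {f \<in> negative_polar K. blinfun_apply f e = -1}"
    by (auto simp: bounded_iff)
  then show ?thesis by (rule finite_dimensional_compact[OF finite_dimensional_dual[OF fd] cl])
qed

end

section \<open>Maximizers and differentiability\<close>

locale cone_absorbing_set = pointed_closed_cone K for K :: "'a::real_normed_vector set" +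
  fixes A :: "'a set"
  assumes A_nonempty: "A \<noteq> {}" and closed_A: "closed A" and A_subset_K: "A \<subseteq> K"
    and add_interior: "\<And>a k. a \<in> A \<Longrightarrow> k \<in> K \<Longrightarrow> k \<noteq> 0 \<Longrightarrow> a + k \<in> interior A"
begin

lemma add_in_A: "a \<in> A \<Longrightarrow> k \<in> K \<Longrightarrow> a + k \<in> A"
  using add_interior[of a k] interior_subset[of A] by (cases "k = 0") auto

lemma A_maximum:
  assumes "f \<in> interior (negative_polar K)"
  obtains a where "a \<in> A" "\<And>x. x \<in> A \<Longrightarrow> blinfun_apply f x \<le> f a"
  using maximum_attained[OF assms closed_A A_subset_K A_nonempty] by blast

lemma support_fun_finite:
  assumes "f \<in> interior (negative_polar K)"
  shows "\<bar>support_fun A f\<bar> \<noteq> \<infinity>"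
  using A_maximum[OF assms] support_fun_eq_maximum by (metis ereal_infinity_cases abs_ereal.simps(1) PInfty_neq_ereal(1))

text \<open>
  The derivative is evaluation at \<open>a\<close>. If \<open>b\<close> maximizes \<open>g\<close>, then
  \<open>0 \<le> \<sigma>\<^sub>A g - \<sigma>\<^sub>A f - (g - f) a \<le> (g - f) (b - a)\<close>, so it suffices that \<open>b\<close> tends to \<open>a\<close> as \<open>g\<close>
  tends to \<open>f\<close>. That follows from compactness, because such \<open>b\<close> stay in a fixed ball.
\<close>

lemma unique_maximizer_differentiable:
  assumes f: "f \<in> interior (negative_polar K)" and a: "a \<in> A"
    and unique: "\<And>x. x \<in> A \<Longrightarrow> x \<noteq> a \<Longrightarrow> blinfun_apply f x < f a"
  shows "ereal_differentiable_at (support_fun A) f"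
proof -
  let ?s = "\<lambda>g. real_of_ereal (support_fun A g)"
  have opn: "\<forall>\<^sub>F g in nhds f. g \<in> interior (negative_polar K)"
    using f by (intro eventually_nhds_in_open) auto
  then have fin: "\<forall>\<^sub>F g in nhds f. \<bar>support_fun A g\<bar> \<noteq> \<infinity>"
    by (rule eventually_mono) (rule support_fun_finite)
  obtain c where c: "c > 0" "\<And>x. x \<in> K \<Longrightarrow> f x \<le> - c * norm x"
    using f uniformly_negative[of f] unfolding interior_negative_polar by blast
  have a_max: "f x \<le> f a" if "x \<in> A" for x
    using unique[OF that] by (cases "x = a") auto
  have sf: "?s f = f a" using support_fun_eq_maximum[OF a a_max] by simp
  \<comment> \<open>If \<open>norm (g - f) \<le> c / 2\<close>, then \<open>g x \<le> - (c / 2) * norm x\<close> on \<open>K\<close>, so \<open>g b \<ge> g a\<close> gives \<open>norm b \<le> R\<close>.\<close>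
  define R where "R = norm a - 2 * f a / c"
  have near: "\<exists>d>0. \<forall>g. norm (g - f) < d \<longrightarrow>
      (\<forall>b\<in>A. (\<forall>x\<in>A. blinfun_apply g x \<le> g b) \<longrightarrow> norm (b - a) < \<epsilon>)" if "\<epsilon> > 0" for \<epsilon>
  proof -
    define T where "T = A \<inter> cball 0 R \<inter> {x. \<epsilon> \<le> norm (x - a)}"
    have "compact T"
      unfolding T_def
      by (intro finite_dimensional_compact[OF fd] closed_Int closed_A closed_Collect_le
          continuous_intros bounded_Int) auto
    moreover have "continuous_on T (blinfun_apply f)" by (intro continuous_intros)
    moreover have "f x < f a" if "x \<in> T" for x
      using that \<open>\<epsilon> > 0\<close> by (intro unique) (auto simp: T_def)
    ultimately obtain \<eta> where \<eta>: "\<eta> > 0" "\<And>x. x \<in> T \<Longrightarrow> f x \<le> f a - \<eta>"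
    proof (cases "T = {}")
      case True
      show ?thesis by (rule that[of 1]) (use True in simp_all)
    next
      case False
      then obtain v where v: "v \<in> T" "\<forall>x\<in>T. f x \<le> f v"
        using continuous_attains_sup[OF \<open>compact T\<close>] \<open>continuous_on T f\<close> by blast
      then show ?thesis using that[of "f a - f v"] \<open>\<And>x. x \<in> T \<Longrightarrow> f x < f a\<close> by force
    qed
    have "f a \<le> 0" using c(2)[of a] c(1) a A_subset_K by (smt (verit) mult_nonneg_nonneg norm_ge_zero subsetD mult_minus_left)
    then have "2 * f a / c \<le> 0" using c(1) by (simp add: divide_nonpos_pos)
    then have R: "norm a \<le> R" "0 \<le> R" using norm_ge_zero[of a] unfolding R_def by linarith+
    \<comment> \<open>On the ball of radius \<open>R\<close>, \<open>f\<close> and \<open>g\<close> differ by at most \<open>d R < \<eta> / 2\<close>.\<close>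
    define d where "d = min (c / 2) (\<eta> / (2 * R + 1))"
    have d: "d > 0" "d \<le> c / 2" "d \<le> \<eta> / (2 * R + 1)"
      using c(1) \<eta>(1) R(2) unfolding d_def by (simp_all only: min.cobounded1 min.cobounded2) simp
    have "2 * d * R < \<eta>"
    proof -
      have "2 * d * R \<le> 2 * (\<eta> / (2 * R + 1)) * R"
        using R(2) d(3) by (intro mult_right_mono) auto
      also have "\<dots> < \<eta>" using R(2) \<eta>(1) by (simp add: divide_simps)
      finally show ?thesis .
    qed
    have "norm (b - a) < \<epsilon>"
      if g: "norm (g - f) < d" and b: "b \<in> A" "\<forall>x\<in>A. blinfun_apply g x \<le> g b" for g b
    proof -
      have close: "\<bar>g x - f x\<bar> \<le> d * norm x" for x
        using norm_blinfun[of "g - f" x] g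
        by (simp add: blinfun.diff_left) (smt (verit) mult_right_mono norm_ge_zero)
      have ab: "g a \<le> g b" using a b(2) by blast
      have "norm b \<le> R"
      proof -
        have "f a - c / 2 * norm a \<le> g a"
          using close[of a] mult_right_mono[OF d(2) norm_ge_zero[of a]] by linarith
        also note ab
        also have "g b \<le> - c * norm b + c / 2 * norm b"
          using close[of b] mult_right_mono[OF d(2) norm_ge_zero[of b]] c(2)[of b] b(1) A_subset_K by force
        finally show ?thesis using c(1) by (simp add: R_def field_simps)
      qed
      then have "d * norm b \<le> d * R" "d * norm a \<le> d * R"
        using d(1) R(1) by (auto intro: mult_left_mono)
      then have "f a - 2 * d * R \<le> f b"
        using close[of a] close[of b] ab by linarith
      then have "f a - \<eta> < f b" using \<open>2 * d * R < \<eta>\<close> by linarith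
      then have "b \<notin> T" using \<eta>(2)[of b] by linarith
      then show ?thesis using b(1) \<open>norm b \<le> R\<close> by (auto simp: T_def)
    qed
    then show ?thesis using d(1) by blast
  qed
  have "(?s has_derivative (\<lambda>h. blinfun_apply h a)) (at f)"
    unfolding has_derivative_at_alt
  proof (intro conjI allI impI)
    show "bounded_linear (\<lambda>h. blinfun_apply h a)" by (intro bounded_linear_intros)
  next
    fix \<epsilon> :: real assume e: "\<epsilon> > 0"
    obtain d where d: "d > 0" "\<And>g b. norm (g - f) < d \<Longrightarrow> b \<in> A \<Longrightarrow>
        (\<forall>x\<in>A. blinfun_apply g x \<le> g b) \<Longrightarrow> norm (b - a) < \<epsilon>"
      using near[OF e] by blast
    obtain r where r: "r > 0" "ball f r \<subseteq> interior (negative_polar K)"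
      using f open_interior open_contains_ball by blast
    have "norm (?s g - ?s f - (g - f) a) \<le> \<epsilon> * norm (g - f)" if g: "norm (g - f) < min d r" for g
    proof -
      have "g \<in> interior (negative_polar K)"
        using g r(2) by (auto simp: dist_norm norm_minus_commute)
      then obtain b where b: "b \<in> A" "\<And>x. x \<in> A \<Longrightarrow> g x \<le> g b"
        using A_maximum by blast
      have "norm (b - a) < \<epsilon>" using d(2)[of g b] g b by simp
      then have "(g - f) (b - a) \<le> norm (g - f) * \<epsilon>"
        using norm_blinfun[of "g - f" "b - a"] by (smt (verit) mult_left_mono norm_ge_zero real_norm_def)
      moreover have "?s g = g b" using support_fun_eq_maximum[OF b] by simp
      moreover have "g a \<le> g b" "f b \<le> f a" using a b a_max by auto
      ultimately show ?thesis
        using sf by (simp add: blinfun.diff_left blinfun.diff_right mult.commute)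
    qed
    then show "\<exists>d>0. \<forall>g. norm (g - f) < d \<longrightarrow> norm (?s g - ?s f - (g - f) a) \<le> \<epsilon> * norm (g - f)"
      using d(1) r(1) by (intro exI[of _ "min d r"]) auto
  qed
  then show ?thesis using fin by (auto simp: ereal_differentiable_at_def differentiable_def)
qed

section \<open>Contact points\<close>

text \<open>
  For \<open>f\<close> on the boundary of the polar, superlevel sets on \<open>A\<close> need not be compact. But for \<open>g\<close> in
  the interior of the polar, \<open>f + s g\<close> does not separate \<open>y\<close> from \<open>A\<close>, and a witness \<open>x \<in> A\<close> of this
  satisfies \<open>g y \<le> g x\<close> because \<open>f x \<le> f y\<close>. So the witnesses for all \<open>s > 0\<close> lie in one compact
  set, on which \<open>f\<close> comes arbitrarily close to \<open>f y\<close> as \<open>s\<close> tends to \<open>0\<close>.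
\<close>

lemma supporting_functional_attained:
  assumes f: "f \<in> negative_polar K" and above: "\<And>a. a \<in> A \<Longrightarrow> blinfun_apply f a \<le> f y"
    and y: "\<And>g. g \<in> interior (negative_polar K) \<Longrightarrow> \<exists>a\<in>A. blinfun_apply g y \<le> g a"
  obtains a where "a \<in> A" "f a = f y"
proof -
  obtain g where g: "g \<in> interior (negative_polar K)"
    using interior_negative_polar_nonempty by blast
  obtain b where b: "b \<in> A" "\<And>x. x \<in> A \<Longrightarrow> g x \<le> g b"
    using A_maximum[OF g] by blast
  let ?Y = "{a \<in> A. g y \<le> g a}"
  have gy: "g y \<le> g b" using y[OF g] b(2) by force
  have "continuous_on ?Y (blinfun_apply f)" by (intro continuous_intros)
  then obtain a where a: "a \<in> A" "\<And>x. x \<in> A \<Longrightarrow> g y \<le> g x \<Longrightarrow> f x \<le> f a"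
    using continuous_attains_sup[OF compact_superlevel[OF g closed_A A_subset_K, of "g y"]] b(1) gy
    by blast
  have "f a = f y"
  proof (rule ccontr)
    assume "f a \<noteq> f y"
    then have less: "f a < f y" using above[OF a(1)] by simp
    define s where "s = (f y - f a) / (g b - g y + 1)"
    have s: "s > 0" using less gy by (simp add: s_def)
    have "f + s *\<^sub>R g \<in> interior (negative_polar K)"
      using f g s unfolding interior_negative_polar
      by (auto simp: negative_polar_def blinfun.add_left blinfun.scaleR_left intro!: add_nonpos_neg mult_pos_neg)
    then obtain x where x: "x \<in> A" "(f + s *\<^sub>R g) y \<le> (f + s *\<^sub>R g) x" using y by blast
    then have le: "f y + s * g y \<le> f x + s * g x"
      by (simp add: blinfun.add_left blinfun.scaleR_left)
    then have "s * g y \<le> s * g x" using above[OF x(1)] by linarith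
    then have "f x \<le> f a" using s a(2)[OF x(1)] by simp
    moreover have "s * g x \<le> s * g b" using s b(2)[OF x(1)] by simp
    ultimately have "f y - f a \<le> s * (g b - g y)" using le by (simp add: algebra_simps)
    also have "\<dots> < f y - f a"
      using less gy by (simp add: s_def divide_simps)
    finally show False by simp
  qed
  then show ?thesis using that a(1) by blast
qed

text \<open>
  If \<open>f k = 0\<close> for a nonzero \<open>k \<in> K\<close>, then \<open>f\<close> is also maximal at \<open>a + k\<close>, an interior point.
\<close>

lemma attained_functional_interior:
  assumes f: "f \<in> negative_polar K" "f \<noteq> 0" and a: "a \<in> A" "\<And>x. x \<in> A \<Longrightarrow> blinfun_apply f x \<le> f a"
  shows "f \<in> interior (negative_polar K)"
proof -
  have "f k < 0" if k: "k \<in> K" "k \<noteq> 0" for k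
  proof (rule ccontr)
    assume "\<not> ?thesis"
    moreover have "f k \<le> 0" using f(1) k(1) by (simp add: negative_polar_def)
    ultimately have "f (a + k) = f a" by (simp add: blinfun.add_right)
    then show False
      using functional_maximal_in_interior_zero[OF add_interior[OF a(1) k]] a(2) f(2) by simp
  qed
  then show ?thesis by (simp add: interior_negative_polar)
qed

text \<open>
  Write \<open>\<sigma>\<^sub>A\<close> for the support function. On functionals with \<open>f e = -1\<close>, subtracting \<open>t e\<close> from \<open>z\<close>
  raises \<open>f z\<close> by \<open>t\<close>. The pairs \<open>(t, f)\<close> with \<open>f\<close> in the compact base of the polar and
  \<open>\<sigma>\<^sub>A f \<le> f z + t\<close> form a closed set, and the least such \<open>t\<close> is the moment of contact. Minimizing
  over pairs avoids the infinite values that \<open>\<sigma>\<^sub>A f - f z\<close> may take on the boundary of the polar.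
\<close>

lemma first_contact:
  assumes e: "e \<in> interior K" "e \<noteq> 0" and z: "\<And>f :: 'a \<Rightarrow>\<^sub>L real. \<exists>a\<in>A. f z \<le> f a"
  obtains t f where "t \<ge> 0" "f \<in> negative_polar K" "f e = - 1"
    "\<And>a. a \<in> A \<Longrightarrow> f a \<le> f (z - t *\<^sub>R e)"
    "\<And>g. g \<in> interior (negative_polar K) \<Longrightarrow> \<exists>a\<in>A. g (z - t *\<^sub>R e) \<le> g a"
proof -
  let ?N = "interior (negative_polar K)"
  let ?Base = "{f \<in> negative_polar K. blinfun_apply f e = -1}"
  have ge: "g e < 0" if "g \<in> ?N" for g
    using that e interior_subset[of K] unfolding interior_negative_polar by blast
  have normalize: "\<exists>s>0. s *\<^sub>R g \<in> ?N \<inter> ?Base" if "g \<in> ?N" for g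
  proof (intro exI conjI)
    show s: "0 < 1 / (- g e)" using ge[OF that] by simp
    have "(1 / (- g e)) *\<^sub>R g \<in> ?N" by (rule scale_interior_polar[OF that s])
    then show "(1 / (- g e)) *\<^sub>R g \<in> ?N \<inter> ?Base"
      using interior_subset[of "negative_polar K"] ge[OF that]
      by (auto simp: blinfun.scaleR_left blinfun.minus_left)
  qed
  obtain f1 where f1: "f1 \<in> ?N" "f1 \<in> ?Base"
    using interior_negative_polar_nonempty normalize by blast
  obtain a1 where a1: "a1 \<in> A" "\<And>x. x \<in> A \<Longrightarrow> f1 x \<le> f1 a1"
    using A_maximum[OF f1(1)] by blast
  \<comment> \<open>Any admissible \<open>t\<close> serves as an upper bound that makes the set of pairs compact.\<close>
  define T where "T = max 0 (f1 a1 - f1 z)"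
  define Q where "Q = ({0..T} \<times> ?Base) \<inter> (\<Inter>a\<in>A. {p. blinfun_apply (snd p) a - snd p z \<le> fst p})"
  have "compact Q"
    unfolding Q_def
    by (intro compact_Int_closed compact_Times compact_polar_base[OF e(1)] compact_Icc closed_INT ballI
        closed_Collect_le continuous_on_diff blinfun.continuous_on continuous_on_fst continuous_on_snd
        continuous_on_const continuous_on_id)
  moreover have "(T, f1) \<in> Q" using f1 a1(2) by (fastforce simp: Q_def T_def)
  moreover have "continuous_on Q fst" by (intro continuous_intros)
  ultimately obtain t f where tf: "(t, f) \<in> Q" "\<And>t' f'. (t', f') \<in> Q \<Longrightarrow> t \<le> t'"
    using continuous_attains_inf[of Q fst] by fastforce
  have f: "f \<in> negative_polar K" "f e = -1" "0 \<le> t" "t \<le> T" "\<And>a. a \<in> A \<Longrightarrow> f a - f z \<le> t"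
    using tf(1) by (auto simp: Q_def)
  have below: "\<exists>a\<in>A. g (z - t *\<^sub>R e) \<le> g a" if g: "g \<in> ?N" for g
  proof (rule ccontr)
    assume neg: "\<not> ?thesis"
    obtain s where s: "s > 0" "s *\<^sub>R g \<in> ?N \<inter> ?Base" using normalize[OF g] by blast
    define h where "h = s *\<^sub>R g"
    have h: "h \<in> ?N" "h \<in> ?Base" using s by (auto simp: h_def)
    obtain b where b: "b \<in> A" "\<And>x. x \<in> A \<Longrightarrow> h x \<le> h b"
      using A_maximum[OF h(1)] by blast
    have "g b < g (z - t *\<^sub>R e)" using neg b(1) by force
    then have "h b < h (z - t *\<^sub>R e)"
      using s(1) by (simp add: h_def blinfun.scaleR_left)
    then have "h b - h z < t" using h(2) by (simp add: blinfun.diff_right blinfun.scaleR_right)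
    \<comment> \<open>As \<open>h\<close> does not separate \<open>z\<close> from \<open>A\<close>, the smaller value \<open>h b - h z\<close> is an admissible time.\<close>
    moreover have "0 \<le> h b - h z" using z[of h] b(2) by force
    ultimately have "(h b - h z, h) \<in> Q" "h b - h z < t"
      using h(2) b(2) f(4) by (auto simp: Q_def)
    then show False using tf(2) by fastforce
  qed
  show ?thesis
    by (rule that[of t f]) (use f below in \<open>auto simp: blinfun.diff_right blinfun.scaleR_right algebra_simps\<close>)
qed

lemma differentiable_contact:
  assumes diff: "\<And>f. f \<in> interior (negative_polar K) \<Longrightarrow> ereal_differentiable_at (support_fun A) f"
    and e: "e \<in> interior K" "e \<noteq> 0" and z: "\<And>f :: 'a \<Rightarrow>\<^sub>L real. \<exists>a\<in>A. f z \<le> f a"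
  obtains t f where "t \<ge> 0" "f \<in> interior (negative_polar K)" "z - t *\<^sub>R e \<in> A"
    "\<And>a. a \<in> A \<Longrightarrow> blinfun_apply f a \<le> f (z - t *\<^sub>R e)"
proof -
  obtain t f where t: "t \<ge> 0" and f: "f \<in> negative_polar K" "f e = - 1"
    and top: "\<And>a. a \<in> A \<Longrightarrow> f a \<le> f (z - t *\<^sub>R e)"
    and below: "\<And>g. g \<in> interior (negative_polar K) \<Longrightarrow> \<exists>a\<in>A. g (z - t *\<^sub>R e) \<le> g a"
    using first_contact[OF e z] by blast
  obtain a where a: "a \<in> A" "f a = f (z - t *\<^sub>R e)"
    using supporting_functional_attained[OF f(1) top below] by blast
  have "f \<noteq> 0" using f(2) by auto
  then have fN: "f \<in> interior (negative_polar K)"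
    using attained_functional_interior[OF f(1) _ a(1)] top a(2) by simp
  have near: "\<forall>\<^sub>F g in nhds f. g \<in> interior (negative_polar K)"
    using fN by (intro eventually_nhds_in_open) auto
  have val: "support_fun A f = ereal (f a)"
    using support_fun_eq_maximum[OF a(1)] top a(2) by simp
  \<comment> \<open>Both points support \<open>A\<close> at \<open>f\<close>; differentiability allows only one.\<close>
  have "z - t *\<^sub>R e = a"
  proof (rule differentiable_support_fun_unique_contact[OF fd diff[OF fN]])
    show "\<forall>\<^sub>F g in nhds f. ereal (blinfun_apply g (z - t *\<^sub>R e)) \<le> support_fun A g"
      using near
    proof eventually_elim
      case (elim g)
      then obtain b where "b \<in> A" "g (z - t *\<^sub>R e) \<le> g b" using below by blast
      then show ?case using support_fun_upper[of b A g] by (meson ereal_less_eq(3) order_trans)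
    qed
    show "\<forall>\<^sub>F g in nhds f. ereal (blinfun_apply g a) \<le> support_fun A g"
      using support_fun_upper[OF a(1)] by simp
  qed (use val a(2) in simp_all)
  then show ?thesis using that[of t f] t fN top a(1) by blast
qed

section \<open>Convexity and strict convexity\<close>

lemma differentiable_imp_convex:
  assumes diff: "\<And>f. f \<in> interior (negative_polar K) \<Longrightarrow> ereal_differentiable_at (support_fun A) f"
    and e: "e \<in> interior K" "e \<noteq> 0"
  shows "convex A"
proof (rule convexI)
  fix x y and u v :: real
  assume xy: "x \<in> A" "y \<in> A" and uv: "0 \<le> u" "0 \<le> v" "u + v = 1"
  let ?z = "u *\<^sub>R x + v *\<^sub>R y"
  have "\<exists>a\<in>A. f ?z \<le> f a" for f :: "'a \<Rightarrow>\<^sub>L real"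
  proof -
    have "f ?z \<le> max (f x) (f y)"
      using uv convex_bound_le[of "f x" "max (f x) (f y)" "f y" u v]
      by (simp add: blinfun.add_right blinfun.scaleR_right)
    then show ?thesis using xy by (auto simp: max_def split: if_splits)
  qed
  then obtain t where t: "t \<ge> 0" "?z - t *\<^sub>R e \<in> A"
    using differentiable_contact[OF diff e, of ?z] by blast
  then have "?z - t *\<^sub>R e + t *\<^sub>R e \<in> A"
    using scale_in_K e interior_subset by (intro add_in_A) auto
  then show "?z \<in> A" by simp
qed

lemma frontier_iff: "x \<in> frontier A \<longleftrightarrow> x \<in> A \<and> x \<notin> interior A"
  using closed_A by (auto simp: frontier_def)

text \<open>
  For a boundary point the contact happens at once, as \<open>y + t e\<close> is interior to \<open>A\<close> for \<open>t > 0\<close>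
  and \<open>y \<in> A\<close>. So the boundary point itself maximizes some \<open>f\<close> over \<open>A\<close>, and then both endpoints
  of the segment do, contradicting uniqueness.
\<close>

lemma differentiable_imp_strict:
  assumes diff: "\<And>f. f \<in> interior (negative_polar K) \<Longrightarrow> ereal_differentiable_at (support_fun A) f"
    and e: "e \<in> interior K" "e \<noteq> 0"
    and ab: "a \<in> A" "b \<in> A" "a \<noteq> b" and l: "0 < l" "l < 1"
  shows "l *\<^sub>R a + (1 - l) *\<^sub>R b \<notin> frontier A"
proof
  let ?z = "l *\<^sub>R a + (1 - l) *\<^sub>R b"
  assume z: "?z \<in> frontier A"
  have nonseparated: "\<exists>x\<in>A. f ?z \<le> f x" for f :: "'a \<Rightarrow>\<^sub>L real"
    using z frontier_iff by blast
  obtain t f where "t \<ge> 0" and f: "f \<in> interior (negative_polar K)" and "?z - t *\<^sub>R e \<in> A"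
    and top: "\<And>a. a \<in> A \<Longrightarrow> f a \<le> f (?z - t *\<^sub>R e)"
    by (rule differentiable_contact[OF _ e nonseparated]) (erule diff, rule that)
  note t = \<open>t \<ge> 0\<close> \<open>?z - t *\<^sub>R e \<in> A\<close>
  have "t = 0"
  proof (rule ccontr)
    assume "t \<noteq> 0"
    then have "?z - t *\<^sub>R e + t *\<^sub>R e \<in> interior A"
      using t scale_in_K e interior_subset by (intro add_interior) auto
    then show False using z frontier_iff by simp
  qed
  then have top: "f x \<le> l * f a + (1 - l) * f b" if "x \<in> A" for x
    using top[OF that] by (simp add: blinfun.add_right blinfun.scaleR_right)
  have "(1 - l) * (f a - f b) \<le> 0" "l * (f b - f a) \<le> 0"
    using top[OF ab(1)] top[OF ab(2)] by (simp_all add: algebra_simps)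
  then have eq: "f a = f b"
    using l by (auto simp: mult_le_0_iff)
  then have "f x \<le> f a" if "x \<in> A" for x
    using top[OF that] by (simp add: algebra_simps)
  then have val: "support_fun A f = ereal (f a)"
    by (rule support_fun_eq_maximum[OF ab(1)])
  have "a = b"
    using support_fun_upper[OF ab(1)] support_fun_upper[OF ab(2)] val eq
    by (intro differentiable_support_fun_unique_contact[OF fd diff[OF f]]) auto
  then show False using ab(3) by simp
qed

lemma strictly_convex_imp_differentiable:
  assumes conv: "convex A"
    and strict: "\<And>a b l. a \<in> frontier A \<Longrightarrow> b \<in> frontier A \<Longrightarrow> a \<noteq> b \<Longrightarrow> 0 < l \<Longrightarrow> l < 1 \<Longrightarrow>
      l *\<^sub>R a + (1 - l) *\<^sub>R b \<notin> frontier A"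
    and nontrivial: "k \<in> K" "k \<noteq> 0"
    and f: "f \<in> interior (negative_polar K)"
  shows "ereal_differentiable_at (support_fun A) f"
proof -
  obtain a where a: "a \<in> A" "\<And>x. x \<in> A \<Longrightarrow> f x \<le> f a"
    using A_maximum[OF f] by blast
  have "f \<noteq> 0" using f nontrivial by (auto simp: interior_negative_polar)
  then have fr: "b \<in> frontier A" if "b \<in> A" "f b = f a" for b
    using functional_maximal_in_interior_zero[of b A f] that a(2) frontier_iff by auto
  have "f b < f a" if b: "b \<in> A" "b \<noteq> a" for b
  proof (rule ccontr)
    assume "\<not> ?thesis"
    then have eq: "f b = f a" using a(2)[OF b(1)] by simp
    let ?m = "(1/2) *\<^sub>R a + (1 - 1/2) *\<^sub>R b"
    have "?m \<in> A" using convexD_alt[OF conv b(1) a(1), of "1/2"] by (simp add: add.commute)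
    moreover have "f ?m = f a" using eq by (simp add: blinfun.add_right blinfun.scaleR_right)
    ultimately have "?m \<in> frontier A" by (rule fr)
    then show False using strict[OF fr[OF a(1)] fr[OF b(1) eq], of "1/2"] b(2) by simp
  qed
  then show ?thesis by (rule unique_maximizer_differentiable[OF f a(1)])
qed

end

theorem corollary17:
  fixes K A :: "'a::real_normed_vector set"
  assumes "finite_dimensional TYPE('a)"
    and "dim (UNIV :: 'a set) \<ge> 2"
    and "closed K" and "convex K" and "cone K" and "pointed K" and "interior K \<noteq> {}"
    and "A \<noteq> {}" and "closed A"
    and "A = A + K" and "A \<subseteq> K - {0}"
    and "A \<subseteq> interior K"
    and "A + (K - {0}) \<subseteq> interior A"
  shows "(\<forall>f \<in> interior (negative_polar K). ereal_differentiable_at (support_fun A) f) \<longleftrightarrow>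
    convex A \<and>
    (\<forall>a \<in> frontier A. \<forall>a' \<in> frontier A. a \<noteq> a' \<longrightarrow>
      (\<forall>l \<in> {0<..<1::real}. l *\<^sub>R a + (1 - l) *\<^sub>R a' \<notin> frontier A))"
proof -
  interpret cone_absorbing_set K A
    using assms by unfold_locales (auto intro: set_plus_intro)
  obtain e where e: "e \<in> interior K" "e \<in> K" "e \<noteq> 0"
    using assms(8,11,12) by blast
  show ?thesis
  proof (intro iffI conjI ballI impI)
    assume diff: "\<forall>f\<in>interior (negative_polar K). ereal_differentiable_at (support_fun A) f"
    then show "convex A" using differentiable_imp_convex e by blast
    fix a b l assume "a \<in> frontier A" "b \<in> frontier A" "a \<noteq> b" "l \<in> {0<..<1::real}"
    then show "l *\<^sub>R a + (1 - l) *\<^sub>R b \<notin> frontier A"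
      using diff differentiable_imp_strict[OF _ e(1,3)] frontier_iff by simp
  next
    fix f assume "convex A \<and> (\<forall>a \<in> frontier A. \<forall>a' \<in> frontier A. a \<noteq> a' \<longrightarrow>
      (\<forall>l \<in> {0<..<1::real}. l *\<^sub>R a + (1 - l) *\<^sub>R a' \<notin> frontier A))"
      and f: "f \<in> interior (negative_polar K)"
    then show "ereal_differentiable_at (support_fun A) f"
      by (intro strictly_convex_imp_differentiable[OF _ _ e(2,3) f]) auto
  qed
qed

end
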